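(* Let $(A,\succ,\prec)$ be an anti-dendriform algebra, $E$ a vector space and $\pi:E\to A$ a surjective linear map with $V=\mathrm{Ker}(\pi)$. Then any anti-dendriform algebra structure $(\succeq,\preceq)$ on $E$ such that $\pi:E\to A$ is a homomorphism of anti-dendriform algebras is isomorphic to a crossed product $A\sharp V$. Furthermore, the isomorphism of anti-dendriform algebras $(E,\succeq,\preceq)\cong A\sharp V$ can be chosen such that it stabilizes $V$ and co-stabilizes $A$.
   Context: All vector spaces and algebras are over a field $k$, and all algebras are finite-dimensional. An anti-dendriform algebra $(A,\succ,\prec)$ is a vector space with two bilinear maps $\succ,\prec:A\times A\to A$ such that, writing $x\cdot y=x\succ y+x\prec y$, for all $x,y,z$: $x\succ(y\succ z)=-(x\cdot y)\succ z=-x\prec(y\cdot z)=(x\prec y)\prec z$ and $(x\succ y)\prec z=x\succ(y\prec z)$. Homomorphisms preserve both operations. A pre-crossed datum of $A$ through a vector space $V$ is a system $C(A,V)=(l_{\succ},r_{\succ},l_{\prec},r_{\prec},\omega_1,\omega_2,\succ_V,\prec_V)$ of linear maps $l_{\succ},r_{\succ},l_{\prec},r_{\prec}:A\to\mathrm{End}(V)$ and bilinear maps $\omega_1,\omega_2:A\times A\to V$, $\succ_V,\prec_V:V\times V\to V$. $A\sharp V$ denotes $A\oplus V$ with $$(x,a)\succeq(y,b)=(x\succ y,\ \omega_1(x,y)+l_{\succ}(x)b+r_{\succ}(y)a+a\succ_V b),$$ $$(x,a)\preceq(y,b)=(x\prec y,\ \omega_2(x,y)+l_{\prec}(x)b+r_{\prec}(y)a+a\prec_V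 b).$$ If this is an anti-dendriform algebra, $A\sharp V$ is called a crossed product of $A$ and $V$ and $C(A,V)$ a crossed system. A linear map between $E$ and $A\sharp V$ stabilizes $V$ if it commutes with the inclusions of $V$ (the inclusion $V\subseteq E$ and $a\mapsto(0,a)$), and co-stabilizes $A$ if it commutes with the projections onto $A$ ($\pi$ and $(x,a)\mapsto x$). *)

theory Defs
  imports "HOL-Analysis.Product_Vector"
begin

text \<open>
  A vector space is a linear subspace of an ambient type carrying a \<open>vector_space\<close> structure; the
  carrier may be all of \<open>UNIV\<close>. This lets the kernel of a linear map be a vector space in its own
  right. Maps are constrained only on the carriers.
\<close>

definition linear_on ::
  "('k::field \<Rightarrow> 'a::ab_group_add \<Rightarrow> 'a) \<Rightarrow> ('k \<Rightarrow> 'b::ab_group_add \<Rightarrow> 'b) \<Rightarrow>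
   'a set \<Rightarrow> 'b set \<Rightarrow> ('a \<Rightarrow> 'b) \<Rightarrow> bool" where
  "linear_on sX sY X Y f \<longleftrightarrow>
     (\<forall>x\<in>X. f x \<in> Y) \<and>
     (\<forall>x\<in>X. \<forall>x'\<in>X. f (x + x') = f x + f x') \<and>
     (\<forall>c. \<forall>x\<in>X. f (sX c x) = sY c (f x))"

definition bilinear_on ::
  "('k::field \<Rightarrow> 'a::ab_group_add \<Rightarrow> 'a) \<Rightarrow> ('k \<Rightarrow> 'b::ab_group_add \<Rightarrow> 'b) \<Rightarrow>
   ('k \<Rightarrow> 'c::ab_group_add \<Rightarrow> 'c) \<Rightarrow> 'a set \<Rightarrow> 'b set \<Rightarrow> 'c set \<Rightarrow> ('a \<Rightarrow> 'b \<Rightarrow> 'c) \<Rightarrow> bool" where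
  "bilinear_on sX sY sZ X Y Z f \<longleftrightarrow>
     (\<forall>x\<in>X. linear_on sY sZ Y Z (\<lambda>y. f x y)) \<and>
     (\<forall>y\<in>Y. linear_on sX sZ X Z (\<lambda>x. f x y))"

locale anti_dendriform = vector_space scale
  for scale :: "'k::field \<Rightarrow> 'a::ab_group_add \<Rightarrow> 'a" +
  fixes A :: "'a set"
    and succ :: "'a \<Rightarrow> 'a \<Rightarrow> 'a" (infixl "\<succ>" 70)
    and prec :: "'a \<Rightarrow> 'a \<Rightarrow> 'a" (infixl "\<prec>" 70)
  assumes subspace_carrier: "subspace A"
    and finite_dimensional: "\<exists>B. finite B \<and> span B = A"
    and bilinear_succ: "bilinear_on scale scale scale A A A (\<succ>)"
    and bilinear_prec: "bilinear_on scale scale scale A A A (\<prec>)"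
    and succ_succ: "\<lbrakk>x \<in> A; y \<in> A; z \<in> A\<rbrakk> \<Longrightarrow> x \<succ> (y \<succ> z) = - ((x \<succ> y + x \<prec> y) \<succ> z)"
    and succ_prec: "\<lbrakk>x \<in> A; y \<in> A; z \<in> A\<rbrakk> \<Longrightarrow>
      - ((x \<succ> y + x \<prec> y) \<succ> z) = - (x \<prec> (y \<succ> z + y \<prec> z))"
    and prec_prec: "\<lbrakk>x \<in> A; y \<in> A; z \<in> A\<rbrakk> \<Longrightarrow>
      - (x \<prec> (y \<succ> z + y \<prec> z)) = (x \<prec> y) \<prec> z"
    and succ_prec_assoc: "\<lbrakk>x \<in> A; y \<in> A; z \<in> A\<rbrakk> \<Longrightarrow> (x \<succ> y) \<prec> z = x \<succ> (y \<prec> z)"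

definition anti_dendriform_hom ::
  "('k::field \<Rightarrow> 'a::ab_group_add \<Rightarrow> 'a) \<Rightarrow> 'a set \<Rightarrow> ('a \<Rightarrow> 'a \<Rightarrow> 'a) \<Rightarrow> ('a \<Rightarrow> 'a \<Rightarrow> 'a) \<Rightarrow>
   ('k \<Rightarrow> 'b::ab_group_add \<Rightarrow> 'b) \<Rightarrow> 'b set \<Rightarrow> ('b \<Rightarrow> 'b \<Rightarrow> 'b) \<Rightarrow> ('b \<Rightarrow> 'b \<Rightarrow> 'b) \<Rightarrow>
   ('a \<Rightarrow> 'b) \<Rightarrow> bool" where
  "anti_dendriform_hom sX X succX precX sY Y succY precY f \<longleftrightarrow>
     linear_on sX sY X Y f \<and>
     (\<forall>x\<in>X. \<forall>x'\<in>X. f (succX x x') = succY (f x) (f x')) \<and>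
     (\<forall>x\<in>X. \<forall>x'\<in>X. f (precX x x') = precY (f x) (f x'))"

definition anti_dendriform_iso ::
  "('k::field \<Rightarrow> 'a::ab_group_add \<Rightarrow> 'a) \<Rightarrow> 'a set \<Rightarrow> ('a \<Rightarrow> 'a \<Rightarrow> 'a) \<Rightarrow> ('a \<Rightarrow> 'a \<Rightarrow> 'a) \<Rightarrow>
   ('k \<Rightarrow> 'b::ab_group_add \<Rightarrow> 'b) \<Rightarrow> 'b set \<Rightarrow> ('b \<Rightarrow> 'b \<Rightarrow> 'b) \<Rightarrow> ('b \<Rightarrow> 'b \<Rightarrow> 'b) \<Rightarrow>
   ('a \<Rightarrow> 'b) \<Rightarrow> bool" where
  "anti_dendriform_iso sX X succX precX sY Y succY precY f \<longleftrightarrow>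
     anti_dendriform_hom sX X succX precX sY Y succY precY f \<and> bij_betw f X Y"

record ('a, 'v) crossed_datum =
  l_succ :: "'a \<Rightarrow> 'v \<Rightarrow> 'v"
  r_succ :: "'a \<Rightarrow> 'v \<Rightarrow> 'v"
  l_prec :: "'a \<Rightarrow> 'v \<Rightarrow> 'v"
  r_prec :: "'a \<Rightarrow> 'v \<Rightarrow> 'v"
  omega1 :: "'a \<Rightarrow> 'a \<Rightarrow> 'v"
  omega2 :: "'a \<Rightarrow> 'a \<Rightarrow> 'v"
  succ_V :: "'v \<Rightarrow> 'v \<Rightarrow> 'v"
  prec_V :: "'v \<Rightarrow> 'v \<Rightarrow> 'v"

text \<open>
  A linear map \<open>A \<rightarrow> End(V)\<close> is given in curried form; it is linear with values in \<open>End(V)\<close> exactly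
  when \<open>bilinear_on sA sV sV A V V\<close> holds.
\<close>

definition pre_crossed_datum ::
  "('k::field \<Rightarrow> 'a::ab_group_add \<Rightarrow> 'a) \<Rightarrow> 'a set \<Rightarrow>
   ('k \<Rightarrow> 'v::ab_group_add \<Rightarrow> 'v) \<Rightarrow> 'v set \<Rightarrow> ('a, 'v) crossed_datum \<Rightarrow> bool" where
  "pre_crossed_datum sA A sV V C \<longleftrightarrow>
     vector_space sV \<and> module.subspace sV V \<and>
     bilinear_on sA sV sV A V V (l_succ C) \<and> bilinear_on sA sV sV A V V (r_succ C) \<and>
     bilinear_on sA sV sV A V V (l_prec C) \<and> bilinear_on sA sV sV A V V (r_prec C) \<and>
     bilinear_on sA sA sV A A V (omega1 C) \<and> bilinear_on sA sA sV A A V (omega2 C) \<and>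
     bilinear_on sV sV sV V V V (succ_V C) \<and> bilinear_on sV sV sV V V V (prec_V C)"

fun crossed_succ ::
  "('a \<Rightarrow> 'a \<Rightarrow> 'a) \<Rightarrow> ('a, 'v::ab_group_add) crossed_datum \<Rightarrow> 'a \<times> 'v \<Rightarrow> 'a \<times> 'v \<Rightarrow> 'a \<times> 'v" where
  "crossed_succ succA C (x, a) (y, b) =
     (succA x y, omega1 C x y + l_succ C x b + r_succ C y a + succ_V C a b)"

fun crossed_prec ::
  "('a \<Rightarrow> 'a \<Rightarrow> 'a) \<Rightarrow> ('a, 'v::ab_group_add) crossed_datum \<Rightarrow> 'a \<times> 'v \<Rightarrow> 'a \<times> 'v \<Rightarrow> 'a \<times> 'v" where
  "crossed_prec precA C (x, a) (y, b) =
     (precA x y, omega2 C x y + l_prec C x b + r_prec C y a + prec_V C a b)"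

definition crossed_system ::
  "('k::field \<Rightarrow> 'a::ab_group_add \<Rightarrow> 'a) \<Rightarrow> 'a set \<Rightarrow> ('a \<Rightarrow> 'a \<Rightarrow> 'a) \<Rightarrow> ('a \<Rightarrow> 'a \<Rightarrow> 'a) \<Rightarrow>
   ('k \<Rightarrow> 'v::ab_group_add \<Rightarrow> 'v) \<Rightarrow> 'v set \<Rightarrow> ('a, 'v) crossed_datum \<Rightarrow> bool" where
  "crossed_system sA A succA precA sV V C \<longleftrightarrow>
     pre_crossed_datum sA A sV V C \<and>
     anti_dendriform (module_prod.scale sA sV) (A \<times> V) (crossed_succ succA C) (crossed_prec precA C)"

definition stabilizes :: "'v set \<Rightarrow> ('v \<Rightarrow> 'a::zero \<times> 'v) \<Rightarrow> bool" where
  "stabilizes V f \<longleftrightarrow> (\<forall>a\<in>V. f a = (0, a))"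

definition co_stabilizes :: "'e set \<Rightarrow> ('e \<Rightarrow> 'a) \<Rightarrow> ('e \<Rightarrow> 'a \<times> 'v) \<Rightarrow> bool" where
  "co_stabilizes E \<pi> f \<longleftrightarrow> (\<forall>e\<in>E. fst (f e) = \<pi> e)"

end

theory Submission
  imports Defs
begin

text \<open>
  Over a field the surjection \<open>\<pi> : E \<rightarrow> A\<close> splits linearly: a basis of \<open>A\<close> can be lifted to
  \<open>E\<close>, which gives a linear \<open>s : A \<rightarrow> E\<close> with \<open>\<pi> \<circ> s = id\<close> (lemma \<open>linear_on_section\<close>). As a
  vector space \<open>E\<close> is then \<open>s(A) \<oplus> V\<close>, through the bijection \<open>\<phi> e = (\<pi> e, e - s (\<pi> e))\<close> whose
  inverse is \<open>(x, a) \<mapsto> s x + a\<close>. This \<open>\<phi>\<close> co-stabilizes \<open>A\<close> by construction, and it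
  stabilizes \<open>V\<close> because \<open>s 0 = 0\<close>.

  Transport the operations of \<open>E\<close> along \<open>\<phi>\<close>. Expanding \<open>(s x + a) \<succeq> (s y + b)\<close> bilinearly gives
  four terms. The three that involve \<open>a\<close> or \<open>b\<close> lie in \<open>V\<close>, because \<open>V\<close> is a two-sided ideal,
  and they are the two actions of \<open>A\<close> on \<open>V\<close> and the multiplication of \<open>V\<close>. The fourth,
  \<open>s x \<succeq> s y\<close>, lies over \<open>x \<succ> y\<close>, so subtracting \<open>s (x \<succ> y)\<close> leaves an element of \<open>V\<close>,
  the cocycle \<open>\<omega>\<^sub>1(x, y)\<close>. The same holds for \<open>\<preceq>\<close>. The transported operations are therefore
  those of the crossed product attached to \<open>section_datum\<close>.

  The anti-dendriform identities on \<open>A \<times> V\<close> need no computation with the components of this datum: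
  they hold because \<open>A \<times> V\<close> is the image of the anti-dendriform algebra \<open>E\<close> under a homomorphism
  (lemma \<open>anti_dendriform_image\<close>).
\<close>

section \<open>Linear and bilinear maps on carriers\<close>

lemma linear_on_zero:
  assumes "linear_on sX sY X Y f" and "vector_space sX" and "module.subspace sX X"
  shows "f 0 = 0"
proof -
  interpret X: vector_space sX by fact
  have "0 \<in> X" using assms(3) by (rule X.subspace_0)
  then have "f (0 + 0) = f 0 + f 0" using assms(1) unfolding linear_on_def by blast
  then show ?thesis by simp
qed

lemma linear_on_diff:
  assumes "linear_on sX sY X Y f" and "vector_space sX" and "module.subspace sX X"
    and "x \<in> X" "x' \<in> X"
  shows "f (x - x') = f x - f x'"
proof -
  interpret X: vector_space sX by fact
  have "x - x' \<in> X" using assms(3-5) by (rule X.subspace_diff)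
  then have "f ((x - x') + x') = f (x - x') + f x'"
    using assms(1,5) unfolding linear_on_def by blast
  then show ?thesis by simp
qed

lemma linear_on_difference:
  assumes "linear_on sX sY X Y f" and "linear_on sX sY X Y g"
    and "vector_space sY" and "module.subspace sY Y"
  shows "linear_on sX sY X Y (\<lambda>x. f x - g x)"
proof -
  interpret Y: vector_space sY by fact
  show ?thesis
    using assms(1,2) Y.subspace_diff[OF assms(4)] unfolding linear_on_def
    by (auto simp: Y.scale_right_diff_distrib)
qed

lemma bilinear_on_difference:
  assumes "bilinear_on sX sY sZ X Y Z f" and "bilinear_on sX sY sZ X Y Z g"
    and "vector_space sZ" and "module.subspace sZ Z"
  shows "bilinear_on sX sY sZ X Y Z (\<lambda>x y. f x y - g x y)"
  using assms(1,2) unfolding bilinear_on_def by (auto intro!: linear_on_difference[OF _ _ assms(3,4)])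

lemma bilinear_on_compose:
  assumes "bilinear_on sX' sY' sZ X' Y' Z h"
    and "linear_on sX sX' X X' p" and "linear_on sY sY' Y Y' q"
  shows "bilinear_on sX sY sZ X Y Z (\<lambda>x y. h (p x) (q y))"
  using assms unfolding bilinear_on_def linear_on_def by simp

lemma bilinear_on_post_compose:
  assumes "bilinear_on sX sY sZ X Y Z h" and "linear_on sZ sW Z W r"
  shows "bilinear_on sX sY sW X Y W (\<lambda>x y. r (h x y))"
  using assms unfolding bilinear_on_def linear_on_def by simp

lemma bilinear_on_swap:
  assumes "bilinear_on sX sY sZ X Y Z h"
  shows "bilinear_on sY sX sZ Y X Z (\<lambda>y x. h x y)"
  using assms unfolding bilinear_on_def by simp

text \<open>
  Used to pass from maps with values in \<open>E\<close>, where composites are formed, to maps with values in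
  the kernel \<open>V\<close>.
\<close>

lemma bilinear_on_corestrict:
  assumes "bilinear_on sX sY sZ X Y Z h" and "\<And>x y. \<lbrakk>x \<in> X; y \<in> Y\<rbrakk> \<Longrightarrow> h x y \<in> Z'"
  shows "bilinear_on sX sY sZ X Y Z' h"
  using assms unfolding bilinear_on_def linear_on_def by simp

lemma bilinear_on_image:
  assumes "bilinear_on sX sX sX X X X m" and "linear_on sX sY X Y f" and "f ` X = Y"
    and X: "vector_space sX" "module.subspace sX X"
    and "\<And>x x'. \<lbrakk>x \<in> X; x' \<in> X\<rbrakk> \<Longrightarrow> f (m x x') = n (f x) (f x')"
  shows "bilinear_on sY sY sY Y Y Y n"
proof -
  interpret X: vector_space sX by fact
  note closed = X.subspace_add[OF X(2)] X.subspace_scale[OF X(2)]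
  have f: "\<And>x x'. \<lbrakk>x \<in> X; x' \<in> X\<rbrakk> \<Longrightarrow> f (x + x') = f x + f x'"
    "\<And>c x. x \<in> X \<Longrightarrow> f (sX c x) = sY c (f x)"
    using assms(2) unfolding linear_on_def by auto
  have m: "\<And>x x'. \<lbrakk>x \<in> X; x' \<in> X\<rbrakk> \<Longrightarrow> m x x' \<in> X"
    "\<And>x x' x''. \<lbrakk>x \<in> X; x' \<in> X; x'' \<in> X\<rbrakk> \<Longrightarrow> m x (x' + x'') = m x x' + m x x''"
    "\<And>x x' x''. \<lbrakk>x \<in> X; x' \<in> X; x'' \<in> X\<rbrakk> \<Longrightarrow> m (x' + x'') x = m x' x + m x'' x"
    "\<And>c x x'. \<lbrakk>x \<in> X; x' \<in> X\<rbrakk> \<Longrightarrow> m x (sX c x') = sX c (m x x')"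
    "\<And>c x x'. \<lbrakk>x \<in> X; x' \<in> X\<rbrakk> \<Longrightarrow> m (sX c x') x = sX c (m x' x)"
    using assms(1) unfolding bilinear_on_def linear_on_def by auto
  show ?thesis
    unfolding bilinear_on_def linear_on_def assms(3)[symmetric]
    by (auto simp: f[symmetric] m closed assms(6)[symmetric])
qed

section \<open>Homomorphic images of anti-dendriform algebras\<close>

text \<open>
  Every identity between elements of the image is the image of the same identity between
  preimages. A finite spanning set is mapped to a finite spanning set, so finite dimension is
  inherited too. The operations on the target are only assumed to be compatible with \<open>f\<close>;
  their bilinearity and the closedness of \<open>Y\<close> are consequences, which is why the lemma can
  turn a mere candidate for a crossed product into an algebra.
\<close>

lemma anti_dendriform_image:
  assumes X: "anti_dendriform sX X succX precX"
    and hom: "anti_dendriform_hom sX X succX precX sY Y succY precY f"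
    and img: "f ` X = Y" and Y: "vector_space sY"
  shows "anti_dendriform sY Y succY precY"
proof -
  interpret X: anti_dendriform sX X succX precX by fact
  interpret Y: vector_space sY by fact
  have lin: "linear_on sX sY X Y f"
    using hom unfolding anti_dendriform_hom_def by blast
  have f: "\<And>x x'. \<lbrakk>x \<in> X; x' \<in> X\<rbrakk> \<Longrightarrow> f (x + x') = f x + f x'"
    "\<And>c x. x \<in> X \<Longrightarrow> f (sX c x) = sY c (f x)"
    using lin unfolding linear_on_def by auto
  have ops: "succY (f x) (f x') = f (succX x x')" "precY (f x) (f x') = f (precX x x')"
    if "x \<in> X" "x' \<in> X" for x x'
    using hom that unfolding anti_dendriform_hom_def by auto
  have "\<And>x x'. \<lbrakk>x \<in> X; x' \<in> X\<rbrakk> \<Longrightarrow> succX x x' \<in> X"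
    "\<And>x x'. \<lbrakk>x \<in> X; x' \<in> X\<rbrakk> \<Longrightarrow> precX x x' \<in> X"
    using X.bilinear_succ X.bilinear_prec unfolding bilinear_on_def linear_on_def by auto
  note closed = this X.subspace_add[OF X.subspace_carrier]
    X.subspace_scale[OF X.subspace_carrier] X.subspace_neg[OF X.subspace_carrier]
  have f0: "f 0 = 0"
    by (rule linear_on_zero[OF lin X.vector_space_axioms X.subspace_carrier])
  have f_neg: "- f x = f (- x)" if "x \<in> X" for x
    using linear_on_diff[OF lin X.vector_space_axioms X.subspace_carrier, of 0 x]
      X.subspace_0[OF X.subspace_carrier] that f0 by simp
  have Ysub: "Y.subspace Y"
  proof (rule Y.subspaceI)
    show "0 \<in> Y" using X.subspace_0[OF X.subspace_carrier] f0 img by force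
    show "y + y' \<in> Y" if "y \<in> Y" "y' \<in> Y" for y y'
      using that closed(3) f(1) unfolding img[symmetric] by (auto simp flip: f)
    show "sY c y \<in> Y" if "y \<in> Y" for c y
      using that closed(4) unfolding img[symmetric] by (auto simp flip: f)
  qed
  obtain B where B: "finite B" "X.span B = X" using X.finite_dimensional by blast
  have "Y.span (f ` B) = Y"
  proof (rule antisym)
    have "f ` B \<subseteq> Y" using B(2) X.span_superset img by blast
    then show "Y.span (f ` B) \<subseteq> Y" using Ysub by (rule Y.span_minimal)
    have "x \<in> X \<and> f x \<in> Y.span (f ` B)" if "x \<in> X.span B" for x
      using that
    proof (induction rule: X.span_induct_alt)
      case base
      show ?case using f0 X.subspace_0[OF X.subspace_carrier] Y.span_zero by simp
    next
      case (step c b x)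
      have b: "b \<in> X" using step B(2) X.span_base by blast
      have "sY c (f b) + f x \<in> Y.span (f ` B)"
        using step by (blast intro: Y.span_add Y.span_scale Y.span_base)
      then show ?case using step b by (simp add: f closed)
    qed
    then show "Y \<subseteq> Y.span (f ` B)" using B(2) img by blast
  qed
  then have "\<exists>B. finite B \<and> Y.span B = Y" using B(1) by blast
  \<comment> \<open>These equations collect an expression in \<open>f x\<close>, \<open>f x'\<close>, \<open>f x''\<close> into the form \<open>f (\<dots>)\<close>.\<close>
  note eqs = img[symmetric] ops closed f_neg f[symmetric]
  show ?thesis
  proof
    show "Y.subspace Y" by fact
    show "\<exists>B. finite B \<and> Y.span B = Y" by fact
    show "bilinear_on sY sY sY Y Y Y succY"
      by (rule bilinear_on_image[where m = succX and n = succY and f = f,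
            OF X.bilinear_succ lin img X.vector_space_axioms X.subspace_carrier ops(1)[symmetric]])
    show "bilinear_on sY sY sY Y Y Y precY"
      by (rule bilinear_on_image[where m = precX and n = precY and f = f,
            OF X.bilinear_prec lin img X.vector_space_axioms X.subspace_carrier ops(2)[symmetric]])
  next
    fix y y' y'' assume "y \<in> Y" "y' \<in> Y" "y'' \<in> Y"
    then obtain x x' x'' where x: "x \<in> X" "x' \<in> X" "x'' \<in> X"
      and y: "y = f x" "y' = f x'" "y'' = f x''" using img by blast
    show "succY y (succY y' y'') = - succY (succY y y' + precY y y') y''"
      by (simp add: y eqs x X.succ_succ)
    show "- succY (succY y y' + precY y y') y'' = - precY y (succY y' y'' + precY y' y'')"
      by (simp add: y eqs x X.succ_prec)
    show "- precY y (succY y' y'' + precY y' y'') = precY (precY y y') y''"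
      by (simp add: y eqs x X.prec_prec)
    show "precY (succY y y') y'' = succY y (precY y' y'')"
      by (simp add: y eqs x X.succ_prec_assoc)
  qed
qed

section \<open>Linear sections of surjections\<close>

text \<open>
  Lift a basis of \<open>Y\<close> to arbitrary preimages and extend linearly. The relation \<open>f (s y) = y\<close> is
  checked by induction over the span, together with \<open>s y \<in> X\<close>, since \<open>f\<close> is known to be
  linear only on \<open>X\<close>.
\<close>

lemma linear_on_section:
  assumes X: "vector_space sX" and Y: "vector_space sY"
    and sub: "module.subspace sX X" "module.subspace sY Y"
    and lin: "linear_on sX sY X Y f" and surj: "f ` X = Y"
  obtains s where "linear_on sY sX Y X s" and "\<And>y. y \<in> Y \<Longrightarrow> f (s y) = y"
proof -
  interpret X: vector_space sX by fact
  interpret Y: vector_space sY by fact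
  interpret YX: vector_space_pair sY sX ..
  obtain B where B: "B \<subseteq> Y" "Y.independent B" "Y \<subseteq> Y.span B"
    using Y.maximal_independent_subset by blast
  have span: "Y.span B = Y" using B sub(2) Y.span_minimal by blast
  define s where "s = YX.construct B (\<lambda>y. SOME x. x \<in> X \<and> f x = y)"
  interpret s: Vector_Spaces.linear sY sX s
    unfolding s_def by (rule YX.linear_construct[OF B(2)])
  have basis: "s b \<in> X \<and> f (s b) = b" if "b \<in> B" for b
  proof -
    have "\<exists>x. x \<in> X \<and> f x = b" using that B(1) surj by blast
    then have "(SOME x. x \<in> X \<and> f x = b) \<in> X \<and> f (SOME x. x \<in> X \<and> f x = b) = b"
      by (rule someI_ex)
    then show ?thesis using YX.construct_basis[OF B(2) that] by (simp add: s_def)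
  qed
  have s: "s y \<in> X \<and> f (s y) = y" if "y \<in> Y.span B" for y
    using that
  proof (induction rule: Y.span_induct_alt)
    case base
    show ?case
      using X.subspace_0[OF sub(1)] linear_on_zero[OF lin X sub(1)] s.zero by simp
  next
    case (step c b y)
    have *: "sX c (s b) \<in> X" using basis[OF step(1)] X.subspace_scale[OF sub(1)] by blast
    then have "f (sX c (s b) + s y) = sY c b + y"
      using lin step basis[OF step(1)] unfolding linear_on_def by auto
    then show ?case
      using * step X.subspace_add[OF sub(1)] by (simp add: s.add s.scale)
  qed
  show ?thesis
  proof
    show "linear_on sY sX Y X s"
      using s span unfolding linear_on_def by (simp add: s.add s.scale)
    show "f (s y) = y" if "y \<in> Y" for y using s span that by blast
  qed
qed

section \<open>The crossed datum of a linear section\<close>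

text \<open>
  The components of the expansion of \<open>(s x + a) \<succeq> (s y + b)\<close> and \<open>(s x + a) \<preceq> (s y + b)\<close>. The
  maps \<open>omega1\<close> and \<open>omega2\<close> measure by how much \<open>s\<close> fails to be a homomorphism.
\<close>

definition section_datum ::
  "('a \<Rightarrow> 'a \<Rightarrow> 'a) \<Rightarrow> ('a \<Rightarrow> 'a \<Rightarrow> 'a) \<Rightarrow> ('e \<Rightarrow> 'e \<Rightarrow> 'e) \<Rightarrow> ('e \<Rightarrow> 'e \<Rightarrow> 'e) \<Rightarrow>
   ('a \<Rightarrow> 'e::ab_group_add) \<Rightarrow> ('a, 'e) crossed_datum" where
  "section_datum succA precA succE precE s =
     \<lparr>l_succ = (\<lambda>x b. succE (s x) b), r_succ = (\<lambda>y a. succE a (s y)),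
      l_prec = (\<lambda>x b. precE (s x) b), r_prec = (\<lambda>y a. precE a (s y)),
      omega1 = (\<lambda>x y. succE (s x) (s y) - s (succA x y)),
      omega2 = (\<lambda>x y. precE (s x) (s y) - s (precA x y)),
      succ_V = succE, prec_V = precE\<rparr>"

text \<open>
  Stated for one pair of operations \<open>m\<close> on \<open>E\<close> and \<open>n\<close> on \<open>A\<close>, so that it covers both halves of
  the datum. Only the values in \<open>V\<close> need an argument: a product with a factor in the kernel is
  mapped by \<open>\<pi>\<close> to a product with a factor \<open>0\<close>, and \<open>m (s x) (s y)\<close> and \<open>s (n x y)\<close> have the
  same image \<open>n x y\<close>.
\<close>

lemma section_components_bilinear:
  assumes E: "vector_space sE" "module.subspace sE E" and A: "vector_space sA" "module.subspace sA A"
    and s: "linear_on sA sE A E s" and sec: "\<And>x. x \<in> A \<Longrightarrow> \<pi> (s x) = x"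
    and \<pi>: "linear_on sE sA E A \<pi>" and V: "V = {e \<in> E. \<pi> e = 0}"
    and m: "bilinear_on sE sE sE E E E m" and n: "bilinear_on sA sA sA A A A n"
    and hom: "\<And>e e'. \<lbrakk>e \<in> E; e' \<in> E\<rbrakk> \<Longrightarrow> \<pi> (m e e') = n (\<pi> e) (\<pi> e')"
  shows "bilinear_on sA sE sE A V V (\<lambda>x b. m (s x) b)"
    and "bilinear_on sA sE sE A V V (\<lambda>y a. m a (s y))"
    and "bilinear_on sA sA sE A A V (\<lambda>x y. m (s x) (s y) - s (n x y))"
    and "bilinear_on sE sE sE V V V m"
proof -
  interpret A: vector_space sA by fact
  interpret E: vector_space sE by fact
  have incl: "linear_on sE sE V E (\<lambda>a. a)" unfolding V linear_on_def by simp
  have zero: "0 \<in> A" by (rule A.subspace_0[OF A(2)])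
  have n0: "n 0 x = 0" "n x 0 = 0" if "x \<in> A" for x
  proof -
    have "linear_on sA sA A A (n x)" "linear_on sA sA A A (\<lambda>y. n y x)"
      using n that unfolding bilinear_on_def by auto
    then show "n 0 x = 0" "n x 0 = 0" by (auto dest: linear_on_zero[OF _ A])
  qed
  have sE: "s x \<in> E" if "x \<in> A" for x using s that unfolding linear_on_def by blast
  have mE: "m e e' \<in> E" if "e \<in> E" "e' \<in> E" for e e'
    using m that unfolding bilinear_on_def linear_on_def by blast
  have nA: "n x y \<in> A" if "x \<in> A" "y \<in> A" for x y
    using n that unfolding bilinear_on_def linear_on_def by blast
  show "bilinear_on sA sE sE A V V (\<lambda>x b. m (s x) b)"
    by (rule bilinear_on_corestrict[OF bilinear_on_compose[OF m s incl]])
      (auto simp: V mE sE hom sec n0)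
  show "bilinear_on sA sE sE A V V (\<lambda>y a. m a (s y))"
    by (rule bilinear_on_corestrict[OF bilinear_on_swap[OF bilinear_on_compose[OF m incl s]]])
      (auto simp: V mE sE hom sec n0)
  show "bilinear_on sE sE sE V V V m"
    by (rule bilinear_on_corestrict[OF bilinear_on_compose[OF m incl incl]])
      (auto simp: V mE hom n0 zero)
  show "bilinear_on sA sA sE A A V (\<lambda>x y. m (s x) (s y) - s (n x y))"
    by (rule bilinear_on_corestrict[OF bilinear_on_difference[OF bilinear_on_compose[OF m s s]
            bilinear_on_post_compose[OF n s] E]])
      (auto simp: V mE sE nA hom sec linear_on_diff[OF \<pi> E] intro: E.subspace_diff[OF E(2)])
qed

text \<open>
  With \<open>p = s (\<pi> e)\<close>, \<open>q = s (\<pi> e')\<close> and \<open>t = s (\<pi> (m e e'))\<close> the left-hand side is the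
  second component of the crossed product of \<open>\<phi> e\<close> and \<open>\<phi> e'\<close>, and the right-hand side
  is the second component of \<open>\<phi> (m e e')\<close>.
\<close>

lemma bilinear_on_split:
  assumes "bilinear_on sE sE sE E E E m"
    and "vector_space sE" "module.subspace sE E"
    and "p \<in> E" "q \<in> E" "e \<in> E" "e' \<in> E"
  shows "m p q - t + m p (e' - q) + m (e - p) q + m (e - p) (e' - q) = m e e' - t"
proof -
  interpret E: vector_space sE by fact
  have d: "e - p \<in> E" "e' - q \<in> E" using assms(4-7) by (auto intro: E.subspace_diff[OF assms(3)])
  have 1: "m x (y - z) = m x y - m x z" "m (y - z) x = m y x - m z x"
    if "x \<in> E" "y \<in> E" "z \<in> E" for x y z
  proof -
    have "linear_on sE sE E E (m x)" "linear_on sE sE E E (\<lambda>y. m y x)"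
      using assms(1) that unfolding bilinear_on_def by auto
    then show "m x (y - z) = m x y - m x z" "m (y - z) x = m y x - m z x"
      by (auto dest: linear_on_diff[OF _ assms(2,3) that(2,3)])
  qed
  show ?thesis using assms(4-7) d by (simp add: 1)
qed

section \<open>Extensions are crossed products\<close>

theorem theorem4p4:
  fixes sA :: "'k::field \<Rightarrow> 'a::ab_group_add \<Rightarrow> 'a"
    and sE :: "'k \<Rightarrow> 'e::ab_group_add \<Rightarrow> 'e"
    and A :: "'a set" and succA precA :: "'a \<Rightarrow> 'a \<Rightarrow> 'a"
    and E V :: "'e set" and succE precE :: "'e \<Rightarrow> 'e \<Rightarrow> 'e"
    and \<pi> :: "'e \<Rightarrow> 'a"
  assumes "anti_dendriform sA A succA precA"
    and "vector_space sE" and "module.subspace sE E"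
    and "linear_on sE sA E A \<pi>" and "\<pi> ` E = A"
    and "V = {e \<in> E. \<pi> e = 0}"
    and "anti_dendriform sE E succE precE"
    and "anti_dendriform_hom sE E succE precE sA A succA precA \<pi>"
  shows "\<exists>C \<phi>. crossed_system sA A succA precA sE V C \<and>
    anti_dendriform_iso sE E succE precE
      (module_prod.scale sA sE) (A \<times> V) (crossed_succ succA C) (crossed_prec precA C) \<phi> \<and>
    stabilizes V \<phi> \<and> co_stabilizes E \<pi> \<phi>"
proof -
  interpret A: anti_dendriform sA A succA precA by fact
  interpret E: anti_dendriform sE E succE precE by fact
  interpret AE: vector_space_prod sA sE ..
  note vA = A.vector_space_axioms A.subspace_carrier
    and vE = assms(2,3)
  note \<pi> = assms(4) and V = assms(6)
  have \<pi>_A: "\<And>e. e \<in> E \<Longrightarrow> \<pi> e \<in> A"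
    and \<pi>_add: "\<And>e e'. \<lbrakk>e \<in> E; e' \<in> E\<rbrakk> \<Longrightarrow> \<pi> (e + e') = \<pi> e + \<pi> e'"
    and \<pi>_scale: "\<And>c e. e \<in> E \<Longrightarrow> \<pi> (sE c e) = sA c (\<pi> e)"
    using \<pi> unfolding linear_on_def by auto
  have \<pi>_succ: "\<pi> (succE e e') = succA (\<pi> e) (\<pi> e')"
    and \<pi>_prec: "\<pi> (precE e e') = precA (\<pi> e) (\<pi> e')" if "e \<in> E" "e' \<in> E" for e e'
    using assms(8) that unfolding anti_dendriform_hom_def by auto
  obtain s where s: "linear_on sA sE A E s" and sec: "\<And>x. x \<in> A \<Longrightarrow> \<pi> (s x) = x"
    using linear_on_section[OF vE(1) vA(1) vE(2) vA(2) \<pi> assms(5)] by blast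
  have s_E: "\<And>x. x \<in> A \<Longrightarrow> s x \<in> E"
    and s_add: "\<And>x x'. \<lbrakk>x \<in> A; x' \<in> A\<rbrakk> \<Longrightarrow> s (x + x') = s x + s x'"
    and s_scale: "\<And>c x. x \<in> A \<Longrightarrow> s (sA c x) = sE c (s x)"
    using s unfolding linear_on_def by auto
  have s0: "s 0 = 0" by (rule linear_on_zero[OF s vA])
  have sub_V: "E.subspace V"
    using E.subspace_0[OF vE(2)] linear_on_zero[OF \<pi> vE]
    by (intro E.subspaceI)
      (auto simp: V \<pi>_add \<pi>_scale intro: E.subspace_add[OF vE(2)] E.subspace_scale[OF vE(2)])
  define C where "C = section_datum succA precA succE precE s"
  define \<phi> where "\<phi> e = (\<pi> e, e - s (\<pi> e))" for e
  have pre: "pre_crossed_datum sA A sE V C"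
    using section_components_bilinear[where \<pi> = \<pi> and s = s and m = succE and n = succA,
        OF vE vA s sec \<pi> V E.bilinear_succ A.bilinear_succ \<pi>_succ]
      section_components_bilinear[where \<pi> = \<pi> and s = s and m = precE and n = precA,
        OF vE vA s sec \<pi> V E.bilinear_prec A.bilinear_prec \<pi>_prec]
      sub_V vE(1)
    unfolding pre_crossed_datum_def C_def section_datum_def by simp
  have \<phi>_in: "\<phi> e \<in> A \<times> V" if "e \<in> E" for e
    using that \<pi>_A[OF that] s_E sec linear_on_diff[OF \<pi> vE]
    by (auto simp: \<phi>_def V intro: E.subspace_diff[OF vE(2)])
  have lin: "linear_on sE (module_prod.scale sA sE) E (A \<times> V) \<phi>"
    unfolding linear_on_def using \<phi>_in
    by (auto simp: \<phi>_def \<pi>_add \<pi>_scale s_add s_scale \<pi>_A AE.scale_def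
        E.scale_right_diff_distrib)
  have hom: "anti_dendriform_hom sE E succE precE
      (module_prod.scale sA sE) (A \<times> V) (crossed_succ succA C) (crossed_prec precA C) \<phi>"
    unfolding anti_dendriform_hom_def using lin
    by (auto simp: \<phi>_def \<pi>_succ \<pi>_prec C_def section_datum_def \<pi>_A s_E
        bilinear_on_split[OF E.bilinear_succ vE] bilinear_on_split[OF E.bilinear_prec vE])
  have inj: "inj_on \<phi> E" by (rule inj_onI) (auto simp: \<phi>_def)
  have surj: "\<phi> ` E = A \<times> V"
  proof
    show "\<phi> ` E \<subseteq> A \<times> V" using \<phi>_in by blast
    show "A \<times> V \<subseteq> \<phi> ` E"
    proof clarify
      fix x a assume xa: "x \<in> A" "a \<in> V"
      then have "s x + a \<in> E" "\<phi> (s x + a) = (x, a)"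
        using s_E sec by (auto simp: \<phi>_def V \<pi>_add intro: E.subspace_add[OF vE(2)])
      then show "(x, a) \<in> \<phi> ` E" by force
    qed
  qed
  have "crossed_system sA A succA precA sE V C"
    unfolding crossed_system_def
    by (intro conjI pre anti_dendriform_image[OF assms(7) hom surj AE.p.vector_space_axioms])
  moreover have "stabilizes V \<phi>" "co_stabilizes E \<pi> \<phi>"
    by (auto simp: stabilizes_def co_stabilizes_def \<phi>_def V s0)
  ultimately show ?thesis
    using hom inj surj unfolding anti_dendriform_iso_def bij_betw_def by blast
qed

end
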